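(* Let $A \in \mathbb{C}^{n\times n}$. Suppose that $\epsilon > 0$ is sufficiently small so that $[0,\epsilon] \subset U \subset \mathbb{R}$ for an open interval $U$ satisfying the following condition: for every $\mu_0 \in \Lambda(A)$ there is a real number $r(\mu_0) > 0$ such that $A + \eta\Delta$ has only one eigenvalue in $B_{r(\mu_0)}(\mu_0)$, which is simple, for every $\eta \in U$ and every $\Delta \in \mathbb{C}^{n\times n}$ such that $\|\Delta\|_2 \leq 1$. Then $$\alpha_\epsilon(A) = \max\{ \mathcal{R}(\epsilon;\mu_0) : \mu_0 \in \Lambda(A) \} = \max_{\mu_0 \in \Lambda(A)} \left\{ \mathrm{Re}(\mu_0) + \epsilon \left( \frac{1}{|y_{\mu_0}^\ast x_{\mu_0}|} \right) \right\} + \mathcal{O}(\epsilon^2),$$ where $x_{\mu_0}$ and $y_{\mu_0}$ denote a unit right eigenvector and a unit left eigenvector, respectively, of $A$ corresponding to its eigenvalue $\mu_0$.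
   Context: $\Lambda(A)$ is the set of eigenvalues of $A$; $\|\cdot\|_2$ is the spectral norm; $B_r(z_0) = \{z \in \mathbb{C} : |z - z_0| < r\}$. The $\epsilon$-pseudospectrum of $A$ is $\Lambda_\epsilon(A) = \bigcup_{\Delta \in \mathbb{C}^{n\times n},\, \|\Delta\|_2 \leq \epsilon} \Lambda(A+\Delta)$ and the $\epsilon$-pseudospectral abscissa is $\alpha_\epsilon(A) = \max\{\mathrm{Re}(z) : z \in \Lambda_\epsilon(A)\}$. For $\mu_0 \in \Lambda(A)$, $\eta \in U$ and $\|\Delta\|_2 \leq 1$, $\mu(\eta;\Delta,\mu_0)$ denotes the unique eigenvalue of $A + \eta\Delta$ in $B_{r(\mu_0)}(\mu_0)$, and $\mathcal{R}(\epsilon;\mu_0) = \max_{\Delta \in \mathbb{C}^{n\times n},\, \|\Delta\|_2 \leq 1} \mathrm{Re}\{\mu(\epsilon;\Delta,\mu_0)\}$. A unit left eigenvector $y$ for $\mu_0$ satisfies $\|y\|_2=1$ and $y^\ast A = \mu_0 y^\ast$. A simple eigenvalue is one of algebraic multiplicity one. The $\mathcal{O}(\epsilon^2)$ term is understood as $\epsilon \to 0^+$ with $A$ fixed. *)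

theory Defs
  imports
    "HOL-Analysis.Analysis"
    "HOL-Computational_Algebra.Polynomial"
    "HOL-Library.Landau_Symbols"
begin

definition spectrum :: "complex ^ 'n ^ 'n \<Rightarrow> complex set" where
  "spectrum A = {z. \<exists>v. v \<noteq> 0 \<and> A *v v = z *s v}"

definition charpoly :: "complex ^ 'n ^ 'n \<Rightarrow> complex poly" where
  "charpoly A = det (mat [:0, 1:] - (\<chi> i j. [:A $ i $ j:]))"

definition alg_mult :: "complex ^ 'n ^ 'n \<Rightarrow> complex \<Rightarrow> nat" where
  "alg_mult A z = order z (charpoly A)"

definition simple_eigenvalue :: "complex ^ 'n ^ 'n \<Rightarrow> complex \<Rightarrow> bool" where
  "simple_eigenvalue A z \<longleftrightarrow> z \<in> spectrum A \<and> alg_mult A z = 1"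

(* The norm on complex ^ 'n is the Euclidean one, so this is the induced 2-norm. *)
definition spectral_norm :: "complex ^ 'n ^ 'n \<Rightarrow> real" where
  "spectral_norm A = onorm (\<lambda>v. A *v v)"

definition pseudospectrum :: "real \<Rightarrow> complex ^ 'n ^ 'n \<Rightarrow> complex set" where
  "pseudospectrum \<epsilon> A = (\<Union>\<Delta>\<in>{\<Delta>. spectral_norm \<Delta> \<le> \<epsilon>}. spectrum (A + \<Delta>))"

(* The set of real parts is infinite in general, so Max does not apply to it. GREATEST denotes
   its largest element, i.e. a maximum that has to be attained, unlike Sup. *)
definition pseudospectral_abscissa :: "real \<Rightarrow> complex ^ 'n ^ 'n \<Rightarrow> real" where
  "pseudospectral_abscissa \<epsilon> A = (GREATEST t. t \<in> Re ` pseudospectrum \<epsilon> A)"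

(* \<mu>(\<eta>; \<Delta>, \<mu>0); the parameter \<rho> is the radius r(\<mu>0). Only meaningful if the ball contains
   exactly one eigenvalue of A + \<eta> \<Delta>. *)
definition perturbed_eigenvalue ::
  "complex ^ 'n ^ 'n \<Rightarrow> real \<Rightarrow> real \<Rightarrow> complex ^ 'n ^ 'n \<Rightarrow> complex \<Rightarrow> complex" where
  "perturbed_eigenvalue A \<rho> \<eta> \<Delta> \<mu>0 = (THE z. z \<in> spectrum (A + \<eta> *\<^sub>R \<Delta>) \<and> z \<in> ball \<mu>0 \<rho>)"

definition max_real_part ::
  "complex ^ 'n ^ 'n \<Rightarrow> real \<Rightarrow> real \<Rightarrow> complex \<Rightarrow> real" where
  "max_real_part A \<rho> \<epsilon> \<mu>0 =
     (GREATEST t. t \<in> (\<lambda>\<Delta>. Re (perturbed_eigenvalue A \<rho> \<epsilon> \<Delta> \<mu>0)) ` {\<Delta>. spectral_norm \<Delta> \<le> 1})"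

definition conj_vec :: "complex ^ 'n \<Rightarrow> complex ^ 'n" where
  "conj_vec y = (\<chi> i. cnj (y $ i))"

(* y^* x. The library's inner product on complex ^ 'n is only its real part. *)
definition hdot :: "complex ^ 'n \<Rightarrow> complex ^ 'n \<Rightarrow> complex" where
  "hdot y x = (\<Sum>i\<in>UNIV. cnj (y $ i) * x $ i)"

definition unit_right_eigenvector :: "complex ^ 'n ^ 'n \<Rightarrow> complex \<Rightarrow> complex ^ 'n \<Rightarrow> bool" where
  "unit_right_eigenvector A \<mu> x \<longleftrightarrow> norm x = 1 \<and> A *v x = \<mu> *s x"

(* y^* A = \<mu> y^* *)
definition unit_left_eigenvector :: "complex ^ 'n ^ 'n \<Rightarrow> complex \<Rightarrow> complex ^ 'n \<Rightarrow> bool" where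
  "unit_left_eigenvector A \<mu> y \<longleftrightarrow> norm y = 1 \<and> conj_vec y v* A = \<mu> *s conj_vec y"

end

theory Submission
  imports Defs "HOL-Computational_Algebra.Fundamental_Theorem_Algebra"
begin

text \<open>
  Throughout, the matrices \<open>A + \<epsilon> \<Delta>\<close> with \<open>\<parallel>\<Delta>\<parallel> \<le> 1\<close> are regarded as the closed ball
  \<open>spectral_cball A \<epsilon>\<close> of the spectral norm, which is compact and convex.

  \<^bold>\<open>The abscissa is the largest \<open>\<R>(\<epsilon>; \<mu>0)\<close>.\<close> Since the characteristic polynomial is monic of
  degree \<open>n\<close>, a number at which \<open>charpoly B\<close> is small is close to an eigenvalue of \<open>B\<close>
  (\<open>eigenvalue_near_approximate_root\<close>). Hence the unique eigenvalue in a fixed open set depends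
  continuously on the matrix (\<open>continuous_on_unique_eigenvalue\<close>), and the maxima over the compact
  ball are attained. It remains to see that the eigenvalues selected by the balls around the
  elements of \<open>spectrum A\<close> are all eigenvalues of the perturbed matrix. The balls may overlap, so
  two of them could conceivably select the same eigenvalue; but the set of matrices at which this
  happens is open and closed in the connected ball of matrices, and it does not contain \<open>A\<close>
  (\<open>unique_eigenvalues_never_meet\<close>). As every eigenvalue of \<open>A\<close> is simple, there are \<open>n\<close> of them,
  so the \<open>n\<close> distinct selected eigenvalues exhaust the spectrum.

  \<^bold>\<open>First-order expansion.\<close> Having \<open>n\<close> distinct eigenvalues, \<open>A\<close> has a basis of eigenvectors, and
  a left eigenvector \<open>y\<close> for \<open>\<mu>0\<close> annihilates all of them but \<open>x\<close>; therefore \<open>y\<^sup>* x \<noteq> 0\<close>, and \<open>A - \<mu>0\<close>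
  is injective, hence bounded below, on the kernel of \<open>y\<^sup>*\<close>. Scaling an eigenvector \<open>v\<close> of \<open>A + E\<close>,
  for an eigenvalue \<open>\<mu>\<close> near \<open>\<mu>0\<close>, such that \<open>y\<^sup>* v = y\<^sup>* x\<close>, this bounds \<open>v - x\<close> by a multiple
  of \<open>\<parallel>E\<parallel>\<close>, and testing the eigenvalue equation with \<open>y\<close> gives \<open>\<mu> = \<mu>0 + y\<^sup>* E x / y\<^sup>* x\<close> up to a quadratic error that is uniform in the
  direction of \<open>E\<close> (\<open>eigenvalue_first_order\<close>). The linear term has real part at most
  \<open>\<parallel>E\<parallel> / \<bar>y\<^sup>* x\<bar>\<close> by the Cauchy-Schwarz inequality, with equality for a suitable multiple of
  \<open>y x\<^sup>*\<close> (\<open>optimal_direction\<close>).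
\<close>

section \<open>Hermitian product and spectral norm\<close>

lemma norm_scalar_vector: "norm (c *s v) = cmod c * norm (v :: complex ^ 'n)"
  by (simp add: norm_vec_def norm_mult L2_set_right_distrib)

lemma scaleR_matrix_vector: "(c *\<^sub>R A) *v v = c *\<^sub>R (A *v (v :: complex ^ 'n))"
  by (simp add: vec_eq_iff matrix_vector_mult_def scaleR_sum_right)

lemma matrix_vector_mult_scalar: "A *v (c *s v) = c *s (A *v (v :: complex ^ 'n))"
  by (simp add: vec_eq_iff matrix_vector_mult_def sum_distrib_left mult_ac)

lemma mat_vector_mult: "mat z *v v = z *s (v :: complex ^ 'n)"
  by (simp add: vec_eq_iff matrix_vector_mult_def mat_def if_distrib[of "\<lambda>x. x * _"] cong: if_cong)

lemma Re_hdot: "Re (hdot y v) = y \<bullet> v"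
  by (simp add: hdot_def inner_vec_def inner_complex_def)

lemma hdot_add: "hdot y (u + v) = hdot y u + hdot y v"
  by (simp add: hdot_def algebra_simps sum.distrib)

lemma hdot_diff: "hdot y (u - v) = hdot y u - hdot y v"
  by (simp add: hdot_def algebra_simps sum_subtractf)

lemma hdot_scalar: "hdot y (c *s v) = c * hdot y v"
  by (simp add: hdot_def sum_distrib_left mult_ac)

lemma hdot_scaleR: "hdot y (c *\<^sub>R v) = of_real c * hdot y v"
proof -
  have "c *\<^sub>R v = of_real c *s v"
    unfolding vec_eq_iff vector_scaleR_component vector_smult_component
    by (simp add: scaleR_conv_of_real)
  then show ?thesis
    by (simp only: hdot_scalar)
qed

lemma hdot_self: "hdot y y = of_real ((norm y)\<^sup>2)"
proof -
  have "hdot y y = (\<Sum>i\<in>UNIV. of_real ((norm (y $ i))\<^sup>2))"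
    unfolding hdot_def unfolding complex_norm_square by (simp only: mult.commute)
  also have "\<dots> = of_real ((norm y)\<^sup>2)"
    by (simp add: norm_vec_def L2_set_def sum_nonneg)
  finally show ?thesis .
qed

text \<open>Turning the phase of \<open>v\<close> makes the Hermitian product real, and for real values it is the
  real inner product, so the real Cauchy-Schwarz inequality suffices.\<close>
lemma norm_hdot_le: "cmod (hdot y v) \<le> norm y * norm v"
proof -
  define c where "c = (if hdot y v = 0 then 1 else cnj (sgn (hdot y v)))"
  have c: "cmod c = 1"
    by (simp add: c_def norm_sgn)
  have "c * hdot y v = of_real (cmod (hdot y v))"
    using complex_norm_square[of "hdot y v"]
    by (cases "hdot y v = 0") (simp_all add: c_def sgn_eq power2_eq_square divide_simps mult.commute)
  then have "cmod (hdot y v) = y \<bullet> (c *s v)"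
    by (metis Re_hdot Re_complex_of_real hdot_scalar)
  also have "\<dots> \<le> norm y * norm (c *s v)"
    by (rule norm_cauchy_schwarz)
  finally show ?thesis
    by (simp add: norm_scalar_vector c)
qed

lemma spectral_norm_le_iff:
  assumes "e \<ge> 0"
  shows "spectral_norm E \<le> e \<longleftrightarrow> (\<forall>v. norm (E *v v) \<le> e * norm v)"
proof
  assume le: "spectral_norm E \<le> e"
  show "\<forall>v. norm (E *v v) \<le> e * norm v"
  proof
    fix v
    have "norm (E *v v) \<le> spectral_norm E * norm v"
      unfolding spectral_norm_def by (rule onorm[OF matrix_vector_mul_bounded_linear])
    also have "\<dots> \<le> e * norm v"
      by (rule mult_right_mono[OF le]) simp
    finally show "norm (E *v v) \<le> e * norm v" .
  qed
qed (auto simp: spectral_norm_def intro!: onorm_bound assms)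

lemma spectral_norm_scaleR: "spectral_norm (c *\<^sub>R E) = \<bar>c\<bar> * spectral_norm E"
proof -
  have "(\<lambda>v. (c *\<^sub>R E) *v v) = (\<lambda>v. c *\<^sub>R (E *v v))"
    by (simp add: scaleR_matrix_vector fun_eq_iff)
  then show ?thesis
    unfolding spectral_norm_def using onorm_scaleR[OF matrix_vector_mul_bounded_linear] by metis
qed

text \<open>The norm of the type of matrices is the Frobenius norm. Its topology is the one in which
  continuity and compactness are expressed, so it has to be controlled by the spectral norm. Any
  constant will do; this one comes from estimating the entries one by one.\<close>
lemma norm_le_spectral_norm:
  fixes E :: "complex ^ 'n ^ 'n"
  assumes "spectral_norm E \<le> e" "e \<ge> 0"
  shows "norm E \<le> real CARD('n) * (real CARD('n) * e)"
proof -
  have entry: "cmod (E $ i $ j) \<le> e" for i j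
  proof -
    have "E $ i $ j = (E *v axis j 1) $ i"
      by (simp add: matrix_vector_mult_def axis_def if_distrib cong: if_cong)
    then have "cmod (E $ i $ j) \<le> norm (E *v axis j 1)"
      by (simp only: Finite_Cartesian_Product.norm_nth_le)
    also have "\<dots> \<le> e"
      using assms spectral_norm_le_iff[of e E, THEN iffD1, THEN spec, of "axis j 1"] by (simp add: norm_axis_1)
    finally show ?thesis .
  qed
  have "norm E \<le> (\<Sum>i\<in>UNIV. norm (E $ i))"
    unfolding norm_vec_def[of E] by (rule L2_set_le_sum) simp
  also have "\<dots> \<le> (\<Sum>i::'n\<in>UNIV. \<Sum>j::'n\<in>UNIV. e)"
  proof (rule sum_mono)
    fix i
    have "norm (E $ i) \<le> (\<Sum>j\<in>UNIV. cmod (E $ i $ j))"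
      unfolding norm_vec_def by (rule L2_set_le_sum) simp
    also have "\<dots> \<le> (\<Sum>j::'n\<in>UNIV. e)"
      by (rule sum_mono[OF entry])
    finally show "norm (E $ i) \<le> (\<Sum>j::'n\<in>UNIV. e)" .
  qed
  finally show ?thesis by simp
qed

text \<open>A set of matrices \<open>B\<close>, not of perturbations \<open>\<Delta>\<close>: eigenvalues are functions of \<open>B\<close>, and the
  balls for different radii are nested, so one function serves all of them.\<close>
definition spectral_cball :: "complex ^ 'n ^ 'n \<Rightarrow> real \<Rightarrow> (complex ^ 'n ^ 'n) set" where
  "spectral_cball A e = {B. spectral_norm (B - A) \<le> e}"

text \<open>As an intersection of conditions on the single vectors \<open>(B - A) v\<close> the ball is visibly closed
  and convex.\<close>
lemma spectral_cball_eq: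
  assumes "e \<ge> 0"
  shows "spectral_cball A e = (\<Inter>v. {B. norm ((B - A) *v v) \<le> e * norm v})"
  using spectral_norm_le_iff[OF assms] by (auto simp: spectral_cball_def)

lemma centre_in_spectral_cball: "e \<ge> 0 \<Longrightarrow> A \<in> spectral_cball A e"
  by (simp add: spectral_cball_eq)

lemma continuous_on_matrix_vector: "continuous_on S (\<lambda>B. (B - A) *v (v :: complex ^ 'n))"
  unfolding matrix_vector_mult_def
  by (intro continuous_intros)

lemma compact_spectral_cball:
  assumes "e \<ge> 0"
  shows "compact (spectral_cball (A :: complex ^ 'n ^ 'n) e)"
  unfolding compact_eq_bounded_closed
proof
  show "bounded (spectral_cball A e)"
  proof (rule boundedI)
    fix B assume "B \<in> spectral_cball A e"
    then have "norm (B - A) \<le> real CARD('n) * (real CARD('n) * e)"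
      using norm_le_spectral_norm[OF _ assms] by (simp add: spectral_cball_def)
    then show "norm B \<le> norm A + real CARD('n) * (real CARD('n) * e)"
      using norm_triangle_sub[of B A] by linarith
  qed
  show "closed (spectral_cball A e)"
    unfolding spectral_cball_eq[OF assms]
  proof (rule closed_INT, rule ballI)
    fix v :: "complex ^ 'n"
    show "closed {B. norm ((B - A) *v v) \<le> e * norm v}"
      by (rule closed_Collect_le[OF continuous_on_norm[OF continuous_on_matrix_vector] continuous_on_const])
  qed
qed

lemma convex_spectral_cball:
  assumes "e \<ge> 0"
  shows "convex (spectral_cball A e)"
  unfolding convex_def
proof (intro ballI allI impI)
  fix B C and s t :: real
  assume B: "B \<in> spectral_cball A e" and C: "C \<in> spectral_cball A e"
    and st: "0 \<le> s" "0 \<le> t" "s + t = 1"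
  have "norm ((s *\<^sub>R B + t *\<^sub>R C - A) *v v) \<le> e * norm v" for v
  proof -
    have "s *\<^sub>R B + t *\<^sub>R C - A = s *\<^sub>R (B - A) + t *\<^sub>R (C - A)"
    proof -
      have "A = s *\<^sub>R A + t *\<^sub>R A"
        using st(3) by (simp flip: scaleR_add_left)
      then show ?thesis
        unfolding scaleR_diff_right by (metis add_diff_add)
    qed
    then have "norm ((s *\<^sub>R B + t *\<^sub>R C - A) *v v)
        = norm (s *\<^sub>R ((B - A) *v v) + t *\<^sub>R ((C - A) *v v))"
      by (simp only: matrix_vector_mult_add_rdistrib scaleR_matrix_vector)
    also have "\<dots> \<le> s * norm ((B - A) *v v) + t * norm ((C - A) *v v)"
      using st by (intro order_trans[OF norm_triangle_ineq]) simp
    also have "\<dots> \<le> s * (e * norm v) + t * (e * norm v)"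
      using B C st by (intro add_mono mult_left_mono) (auto simp: spectral_cball_eq[OF assms])
    also have "\<dots> = e * norm v"
      using st(3) by (simp flip: distrib_right)
    finally show ?thesis .
  qed
  then show "s *\<^sub>R B + t *\<^sub>R C \<in> spectral_cball A e"
    by (simp add: spectral_cball_eq[OF assms])
qed

lemma spectral_cball_eq_image:
  assumes "e > 0"
  shows "spectral_cball A e = (\<lambda>\<Delta>. A + e *\<^sub>R \<Delta>) ` {\<Delta>. spectral_norm \<Delta> \<le> 1}" (is "?L = ?R")
proof
  show "?R \<subseteq> ?L"
    using assms by (auto simp: spectral_cball_def spectral_norm_scaleR)
  show "?L \<subseteq> ?R"
  proof
    fix B assume "B \<in> ?L"
    then have "spectral_norm ((1 / e) *\<^sub>R (B - A)) \<le> 1" "B = A + e *\<^sub>R ((1 / e) *\<^sub>R (B - A))"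
      using assms by (auto simp: spectral_cball_def spectral_norm_scaleR)
    then show "B \<in> ?R" by blast
  qed
qed

section \<open>Eigenvalues as roots of the characteristic polynomial\<close>

lemma poly_charpoly: "poly (charpoly A) z = det (mat z - A)"
proof -
  have entry: "poly ((mat [:0, 1:] - (\<chi> i j. [:A $ i $ j:])) $ i $ j) z = (mat z - A) $ i $ j" for i j
    by (simp add: mat_def)
  show ?thesis
    unfolding charpoly_def det_def poly_sum poly_mult poly_prod entry by simp
qed

lemma spectrum_iff_charpoly: "z \<in> spectrum A \<longleftrightarrow> poly (charpoly A) z = 0"
proof -
  have "(mat z - A) *v v = 0 \<longleftrightarrow> A *v v = z *s v" for v
    by (auto simp: matrix_vector_mult_diff_rdistrib mat_vector_mult)
  then have "z \<in> spectrum A \<longleftrightarrow> (\<exists>v. v \<noteq> 0 \<and> (mat z - A) *v v = 0)"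
    by (auto simp: spectrum_def)
  also have "\<dots> \<longleftrightarrow> \<not> invertible (mat z - A)"
    unfolding invertible_left_inverse matrix_left_invertible_ker by blast
  finally show ?thesis
    by (simp add: invertible_det_nz poly_charpoly)
qed

text \<open>In the Leibniz expansion only the identity permutation reaches the top degree: any other
  permutation picks at least one constant off-diagonal entry.\<close>
lemma charpoly_monic:
  fixes A :: "complex ^ 'n ^ 'n"
  shows "degree (charpoly A) = CARD('n)" and "lead_coeff (charpoly A) = 1"
proof -
  define M where "M = mat [:0, 1:] - (\<chi> i j. [:A $ i $ j:])"
  define P where "P = {p. p permutes (UNIV :: 'n set)}"
  define T where "T p = of_int (sign p) * (\<Prod>i\<in>UNIV. M $ i $ p i)" for p
  have diag: "M $ i $ i = [:- (A $ i $ i), 1:]" for i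
    by (simp add: M_def mat_def)
  have off: "degree (M $ i $ j) = 0" if "i \<noteq> j" for i j
    using that by (simp add: M_def mat_def)
  have fin: "finite P"
    unfolding P_def by (rule finite_permutations) simp
  have id: "id \<in> P"
    by (simp add: P_def permutes_id)
  have split: "charpoly A = T id + (\<Sum>p\<in>P - {id}. T p)"
    unfolding charpoly_def det_def M_def[symmetric] P_def[symmetric] T_def[symmetric]
    by (rule sum.remove[OF fin id])
  have T_id: "T id = (\<Prod>i\<in>UNIV. [:- (A $ i $ i), 1:])"
    by (simp add: T_def diag)
  have deg_id: "degree (T id) = CARD('n)"
    unfolding T_id by (subst degree_prod_eq_sum_degree) auto
  have lead_id: "lead_coeff (T id) = 1"
    unfolding T_id lead_coeff_prod by simp
  have deg_other: "degree (T p) < CARD('n)" if p: "p \<in> P - {id}" for p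
  proof -
    obtain k where k: "p k \<noteq> k"
      using p by (auto simp: fun_eq_iff)
    have "degree (T p) \<le> degree (\<Prod>i\<in>UNIV. M $ i $ p i)"
      unfolding T_def by (rule order_trans[OF degree_mult_le]) simp
    also have "\<dots> \<le> (\<Sum>i\<in>UNIV. degree (M $ i $ p i))"
      using degree_prod_sum_le[of UNIV "\<lambda>i. M $ i $ p i"] by (simp add: o_def)
    also have "\<dots> \<le> (\<Sum>i\<in>UNIV - {k}. 1)"
    proof (subst sum.remove[of UNIV k])
      have "degree (M $ i $ p i) \<le> 1" for i
        by (cases "p i = i") (auto simp: diag off)
      then have "(\<Sum>i\<in>UNIV - {k}. degree (M $ i $ p i)) \<le> (\<Sum>i\<in>UNIV - {k}. 1)"
        by (rule sum_mono)
      then show "degree (M $ k $ p k) + (\<Sum>i\<in>UNIV - {k}. degree (M $ i $ p i)) \<le> (\<Sum>i\<in>UNIV - {k}. 1)"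
        using off[of k "p k"] k by simp
    qed auto
    also have "\<dots> < CARD('n)"
      by simp
    finally show ?thesis .
  qed
  have "degree (\<Sum>p\<in>P - {id}. T p) < CARD('n)"
    using deg_other by (intro degree_sum_less) auto
  then have less: "degree (\<Sum>p\<in>P - {id}. T p) < degree (T id)"
    by (simp only: deg_id)
  show "degree (charpoly A) = CARD('n)"
    unfolding split degree_add_eq_left[OF less] by (rule deg_id)
  show "lead_coeff (charpoly A) = 1"
    unfolding split degree_add_eq_left[OF less] coeff_add coeff_eq_0[OF less] lead_id by simp
qed

lemma charpoly_nonzero: "charpoly A \<noteq> 0"
  using charpoly_monic(2)[of A] by auto

lemma finite_spectrum: "finite (spectrum A)"
  using poly_roots_finite[OF charpoly_nonzero[of A]] by (simp add: spectrum_iff_charpoly[symmetric])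

lemma charpoly_factorization: "charpoly A = (\<Prod>z\<in>spectrum A. [:-z, 1:] ^ alg_mult A z)"
proof -
  have "smult 1 (\<Prod>z\<in>spectrum A. [:-z, 1:] ^ alg_mult A z) = charpoly A"
    using complex_poly_decompose[of "charpoly A"]
    unfolding charpoly_monic(2) alg_mult_def spectrum_iff_charpoly[symmetric] by simp
  then show ?thesis by simp
qed

lemma sum_alg_mult:
  fixes A :: "complex ^ 'n ^ 'n"
  shows "(\<Sum>z\<in>spectrum A. alg_mult A z) = CARD('n)"
proof -
  have "degree (charpoly A) = (\<Sum>z\<in>spectrum A. alg_mult A z)"
    by (subst charpoly_factorization, subst degree_prod_eq_sum_degree) (auto simp: degree_power_eq)
  then show ?thesis
    by (simp add: charpoly_monic)
qed

lemma spectrum_nonempty: "spectrum (A :: complex ^ 'n ^ 'n) \<noteq> {}"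
  using sum_alg_mult[of A] by auto

lemma card_spectrum_le: "card (spectrum (A :: complex ^ 'n ^ 'n)) \<le> CARD('n)"
proof -
  have "alg_mult A z \<ge> 1" if "z \<in> spectrum A" for z
    using that order_root[of "charpoly A" z] charpoly_nonzero[of A]
    by (simp add: alg_mult_def spectrum_iff_charpoly Suc_le_eq)
  then have "(\<Sum>z\<in>spectrum A. 1) \<le> (\<Sum>z\<in>spectrum A. alg_mult A z)"
    by (intro sum_mono)
  then show ?thesis
    by (simp add: sum_alg_mult)
qed

lemma card_spectrum_simple:
  fixes A :: "complex ^ 'n ^ 'n"
  assumes "\<And>z. z \<in> spectrum A \<Longrightarrow> simple_eigenvalue A z"
  shows "card (spectrum A) = CARD('n)"
  using sum_alg_mult[of A] assms by (simp add: simple_eigenvalue_def)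

text \<open>The monic polynomial \<open>charpoly B\<close> is a product of \<open>n\<close> linear factors, so at \<open>z\<close> at least
  one factor is as small as the \<open>n\<close>-th root of its modulus.\<close>
lemma eigenvalue_near_approximate_root:
  fixes B :: "complex ^ 'n ^ 'n"
  assumes "e > 0" "cmod (det (mat z - B)) < e ^ CARD('n)"
  shows "\<exists>w\<in>spectrum B. cmod (z - w) < e"
proof (rule ccontr)
  assume "\<not> ?thesis"
  then have far: "\<And>w. w \<in> spectrum B \<Longrightarrow> e \<le> cmod (z - w)"
    by force
  have "e ^ CARD('n) = (\<Prod>w\<in>spectrum B. e ^ alg_mult B w)"
    unfolding sum_alg_mult[of B, symmetric] by (rule power_sum)
  also have "\<dots> \<le> (\<Prod>w\<in>spectrum B. cmod (z - w) ^ alg_mult B w)"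
    using far assms(1) by (intro prod_mono) (auto intro: power_mono)
  also have "\<dots> = cmod (poly (charpoly B) z)"
    by (subst charpoly_factorization) (simp add: poly_prod prod_norm[symmetric] norm_power)
  finally show False
    using assms(2) by (simp add: poly_charpoly)
qed

section \<open>Continuation of eigenvalues\<close>

text \<open>Only the lower half of the continuity of the spectrum: eigenvalues do not disappear.\<close>
lemma eventually_eigenvalue_near:
  fixes B0 :: "complex ^ 'n ^ 'n"
  assumes "z \<in> spectrum B0" "e > 0"
  shows "\<forall>\<^sub>F B in at B0 within S. \<exists>w\<in>spectrum B. cmod (z - w) < e"
proof -
  have "((\<lambda>B. det (mat z - B)) \<longlongrightarrow> det (mat z - B0)) (at B0 within S)"
    unfolding det_def by (intro tendsto_intros)
  then have "((\<lambda>B. det (mat z - B)) \<longlongrightarrow> 0) (at B0 within S)"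
    using assms(1) by (simp add: spectrum_iff_charpoly poly_charpoly)
  then have "\<forall>\<^sub>F B in at B0 within S. cmod (det (mat z - B)) < e ^ CARD('n)"
    using assms(2) by (auto dest: tendstoD[of _ 0 _ "e ^ CARD('n)"])
  then show ?thesis
    by (rule eventually_mono) (rule eigenvalue_near_approximate_root[OF assms(2)])
qed

text \<open>Some eigenvalue of a nearby matrix \<open>B\<close> is close to \<open>g B0\<close>, hence lies in \<open>D\<close>, hence is \<open>g B\<close>.\<close>
lemma continuous_on_unique_eigenvalue:
  assumes "open D" and unique: "\<And>B. B \<in> S \<Longrightarrow> spectrum B \<inter> D = {g B}"
  shows "continuous_on S g"
  unfolding continuous_on_def
proof (intro ballI tendstoI)
  fix B0 and e :: real
  assume B0: "B0 \<in> S" and e: "e > 0"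
  have g: "g B0 \<in> spectrum B0" "g B0 \<in> D"
    using unique[OF B0] by auto
  obtain d where d: "d > 0" "ball (g B0) d \<subseteq> D"
    using assms(1) g(2) open_contains_ball by blast
  have "\<forall>\<^sub>F B in at B0 within S. B \<in> S"
    by (simp add: eventually_at_filter)
  moreover have "\<forall>\<^sub>F B in at B0 within S. \<exists>w\<in>spectrum B. cmod (g B0 - w) < min d e"
    by (rule eventually_eigenvalue_near[OF g(1)]) (use d(1) e in simp)
  ultimately show "\<forall>\<^sub>F B in at B0 within S. dist (g B) (g B0) < e"
  proof eventually_elim
    case (elim B)
    then obtain w where w: "w \<in> spectrum B" "cmod (g B0 - w) < d" "cmod (g B0 - w) < e"
      by auto
    then have "w \<in> D"
      using d(2) by (auto simp: dist_norm)
    then have "w = g B"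
      using unique[OF elim(1)] w(1) by blast
    then show ?case
      using w(3) by (simp add: dist_norm norm_minus_commute)
  qed
qed

text \<open>The set of matrices at which the two eigenvalues agree is closed by continuity. It is also
  open, because agreement just says that the first eigenvalue lies in the open set \<open>D'\<close>, where the
  second one has no competitor.\<close>
lemma unique_eigenvalues_never_meet:
  assumes "connected S" "open D" "open D'"
    and g: "\<And>B. B \<in> S \<Longrightarrow> spectrum B \<inter> D = {g B}"
    and h: "\<And>B. B \<in> S \<Longrightarrow> spectrum B \<inter> D' = {h B}"
    and "A \<in> S" "g A \<noteq> h A" "B \<in> S"
  shows "g B \<noteq> h B"
proof -
  have cont: "continuous_on S g" "continuous_on S h"
    using continuous_on_unique_eigenvalue[OF assms(2)] continuous_on_unique_eigenvalue[OF assms(3)] g h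
    by blast+
  define T where "T = {B \<in> S. g B = h B}"
  have "T = S \<inter> (\<lambda>B. g B - h B) -` {0}"
    by (auto simp: T_def)
  then have "closedin (top_of_set S) T"
    using continuous_closedin_preimage[OF continuous_on_diff[OF cont], of "{0}"] by simp
  moreover have "T = S \<inter> g -` D'"
    using g h by (auto simp: T_def) blast+
  then have "openin (top_of_set S) T"
    using continuous_openin_preimage_gen[OF cont(1) assms(3)] by simp
  ultimately have "T = {} \<or> T = S"
    using assms(1) by (auto simp: connected_clopen)
  then show ?thesis
    using assms(6,7,8) by (auto simp: T_def)
qed

text \<open>The continued eigenvalues stay pairwise distinct, so there are already as many of them as a
  matrix of this size can have.\<close>
lemma spectrum_eq_continued_eigenvalues:
  fixes A :: "complex ^ 'n ^ 'n"
  assumes "connected S" "A \<in> S" "B \<in> S"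
    and simple: "\<And>z. z \<in> spectrum A \<Longrightarrow> simple_eigenvalue A z"
    and D: "\<And>z. z \<in> spectrum A \<Longrightarrow> open (D z)" "\<And>z. z \<in> spectrum A \<Longrightarrow> z \<in> D z"
    and g: "\<And>z B. z \<in> spectrum A \<Longrightarrow> B \<in> S \<Longrightarrow> spectrum B \<inter> D z = {g z B}"
  shows "spectrum B = (\<lambda>z. g z B) ` spectrum A"
proof -
  have start: "g z A = z" if "z \<in> spectrum A" for z
    using g[OF that assms(2)] D(2)[OF that] that by (metis IntI singletonD)
  have "inj_on (\<lambda>z. g z B) (spectrum A)"
  proof (rule inj_onI, rule ccontr)
    fix z w
    assume zw: "z \<in> spectrum A" "w \<in> spectrum A" "g z B = g w B" "z \<noteq> w"
    have "g z B \<noteq> g w B"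
      by (rule unique_eigenvalues_never_meet[OF assms(1) D(1)[OF zw(1)] D(1)[OF zw(2)] g[OF zw(1)]
            g[OF zw(2)] assms(2) _ assms(3)]) (use zw start in auto)
    with zw(3) show False by simp
  qed
  then have "card ((\<lambda>z. g z B) ` spectrum A) = CARD('n)"
    using card_spectrum_simple[OF simple] by (simp add: card_image)
  moreover have "(\<lambda>z. g z B) ` spectrum A \<subseteq> spectrum B"
    using g assms(3) by blast
  ultimately show ?thesis
    using card_seteq[OF finite_spectrum[of B]] card_spectrum_le[of B] by metis
qed

section \<open>Left and right eigenvectors\<close>

text \<open>Linear independence of eigenvectors for distinct eigenvalues, with the coefficients absorbed
  into the vectors: these may be zero. Applying \<open>A - a\<close> to the sum removes the summand for \<open>a\<close>
  and multiplies the others by non-zero factors.\<close>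
lemma eigenvector_sum_zero:
  fixes A :: "complex ^ 'n ^ 'n"
  assumes "finite Z" "\<And>z. z \<in> Z \<Longrightarrow> A *v u z = z *s u z" "(\<Sum>z\<in>Z. u z) = 0"
  shows "\<forall>z\<in>Z. u z = 0"
  using assms
proof (induction Z arbitrary: u rule: finite_induct)
  case (insert a Z)
  have eig: "A *v u z - a *s u z = (z - a) *s u z" if "z \<in> insert a Z" for z
    using insert.prems(1)[OF that] by (simp add: vector_sub_rdistrib)
  have "(\<Sum>z\<in>insert a Z. (z - a) *s u z) = (\<Sum>z\<in>insert a Z. A *v u z - a *s u z)"
    using eig by (intro sum.cong) auto
  also have "\<dots> = A *v (\<Sum>z\<in>insert a Z. u z) - a *s (\<Sum>z\<in>insert a Z. u z)"
    by (simp only: sum_subtractf vec.scale_sum_right linear_sum[OF matrix_vector_mul_linear])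
  finally have "(\<Sum>z\<in>Z. (z - a) *s u z) = 0"
    using insert.hyps insert.prems(2) by simp
  then have "\<forall>z\<in>Z. (z - a) *s u z = 0"
    using insert.prems(1)
    by (intro insert.IH) (simp only: matrix_vector_mult_scalar insertI2 vector_smult_assoc mult.commute)
  then have "\<forall>z\<in>Z. u z = 0"
    using insert.hyps(2) by auto
  then show ?case
    using insert.hyps insert.prems(2) by simp
qed simp

lemma span_eigenvectors:
  fixes A :: "complex ^ 'n ^ 'n"
  assumes "card (spectrum A) = CARD('n)"
    and u: "\<And>z. z \<in> spectrum A \<Longrightarrow> A *v u z = z *s u z" "\<And>z. z \<in> spectrum A \<Longrightarrow> u z \<noteq> 0"
  shows "vec.span (u ` spectrum A) = UNIV"
proof -
  have inj: "inj_on u (spectrum A)"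
  proof (rule inj_onI)
    fix z w assume zw: "z \<in> spectrum A" "w \<in> spectrum A" "u z = u w"
    then have "z *s u z = w *s u z"
      using u(1)[OF zw(1)] u(1)[OF zw(2)] zw(3) by metis
    then show "z = w"
      using u(2)[OF zw(1)] by (metis vec.scale_cancel_right)
  qed
  have "vec.independent (u ` spectrum A)"
  proof (rule vec.independent_if_scalars_zero)
    show "finite (u ` spectrum A)"
      by (simp add: finite_spectrum)
    fix f v
    assume "(\<Sum>v\<in>u ` spectrum A. f v *s v) = 0" and v: "v \<in> u ` spectrum A"
    then have "(\<Sum>z\<in>spectrum A. f (u z) *s u z) = 0"
      by (simp add: sum.reindex[OF inj])
    then have "\<forall>z\<in>spectrum A. f (u z) *s u z = 0"
      using u(1) by (intro eigenvector_sum_zero[OF finite_spectrum[of A], of A])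
        (auto simp: matrix_vector_mult_scalar mult.commute)
    then show "f v = 0"
      using v u(2) by auto
  qed
  moreover have "card (u ` spectrum A) = CARD('n)"
    using assms(1) by (simp add: card_image[OF inj])
  ultimately show ?thesis
    using vec.card_ge_dim_independent[of "u ` spectrum A" UNIV]
    by (metis subset_UNIV order_refl top.extremum_unique vec_dim_card)
qed

lemma hdot_left_eigenvector:
  assumes "conj_vec y v* A = z *s conj_vec y"
  shows "hdot y (A *v v) = z * hdot y v"
proof -
  have "hdot y (A *v v) = (\<Sum>j\<in>UNIV. (conj_vec y v* A) $ j * v $ j)"
    unfolding hdot_def conj_vec_def matrix_vector_mult_def vector_matrix_mult_def
    by (simp add: sum_distrib_left sum_distrib_right mult_ac) (rule sum.swap)
  also have "\<dots> = z * hdot y v"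
    unfolding assms by (simp add: hdot_def conj_vec_def sum_distrib_left mult_ac)
  finally show ?thesis .
qed

text \<open>A left eigenvector annihilates the right eigenvectors of every other eigenvalue. If it were
  also orthogonal to one of its own eigenvalue, it would be orthogonal to a basis.\<close>
lemma left_right_eigenvectors_not_orthogonal:
  fixes A :: "complex ^ 'n ^ 'n"
  assumes card: "card (spectrum A) = CARD('n)"
    and y: "conj_vec y v* A = z *s conj_vec y" "y \<noteq> 0"
    and x: "A *v x = z *s x" "x \<noteq> 0"
  shows "hdot y x \<noteq> 0"
proof
  assume orth: "hdot y x = 0"
  have "\<forall>w\<in>spectrum A. \<exists>v. v \<noteq> 0 \<and> A *v v = w *s v"
    by (simp add: spectrum_def)
  then obtain v where v: "\<And>w. w \<in> spectrum A \<Longrightarrow> v w \<noteq> 0 \<and> A *v v w = w *s v w"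
    by metis
  \<comment> \<open>Choosing \<open>x\<close> itself as the eigenvector for \<open>z\<close> makes the whole basis orthogonal to \<open>y\<close>.\<close>
  define u where "u = v(z := x)"
  have u: "A *v u w = w *s u w" "u w \<noteq> 0" if "w \<in> spectrum A" for w
    using v[OF that] x by (auto simp: u_def)
  have "hdot y (u w) = 0" if "w \<in> spectrum A" for w
  proof (cases "w = z")
    case False
    have "z * hdot y (u w) = w * hdot y (u w)"
      using hdot_left_eigenvector[OF y(1), of "u w"] u(1)[OF that] by (simp only: hdot_scalar)
    with False show ?thesis by auto
  qed (simp add: u_def orth)
  then have basis: "hdot y b = 0" if "b \<in> u ` spectrum A" for b
    using that by auto
  have sub: "vec.subspace {v. hdot y v = 0}"
    unfolding vec.subspace_def by (auto simp: hdot_add hdot_scalar hdot_def[of y 0])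
  have "vec.span (u ` spectrum A) \<subseteq> {v. hdot y v = 0}"
    using basis by (intro vec.span_minimal sub) auto
  then have "hdot y y = 0"
    using span_eigenvectors[OF card u] by auto
  then show False
    using y(2) by (simp add: hdot_self)
qed

section \<open>First-order perturbation of a simple eigenvalue\<close>

text \<open>The eigenvector \<open>v\<close> of \<open>A + E\<close> is normalised by \<open>y\<^sup>* v = y\<^sup>* x\<close> instead of its norm, so that
  \<open>w = v - x\<close> lies in the kernel \<open>W\<close> of \<open>y\<^sup>*\<close>, where \<open>A - z\<close> is bounded below by some \<open>c\<close>. Since
  \<open>(A - z) w = (\<mu> - z) v - E v\<close>, the vector \<open>w\<close> is of the order of \<open>e\<close>. Applying \<open>y\<^sup>*\<close> to
  the same identity kills the left-hand side and leaves \<open>(\<mu> - z) y\<^sup>* x = y\<^sup>* E x + y\<^sup>* E w\<close>, where the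
  last term is quadratic. The bound does not depend on the direction of \<open>E\<close>, as is needed for
  maximising over it.\<close>
lemma eigenvalue_first_order:
  fixes A :: "complex ^ 'n ^ 'n"
  assumes y: "conj_vec y v* A = z *s conj_vec y" "norm y = 1"
    and x: "A *v x = z *s x" "norm x = 1"
    and nonorth: "\<And>w. A *v w = z *s w \<Longrightarrow> w \<noteq> 0 \<Longrightarrow> hdot y w \<noteq> 0"
  obtains C d where "d > 0"
    "\<And>E e \<mu>. \<mu> \<in> spectrum (A + E) \<Longrightarrow> spectral_norm E \<le> e \<Longrightarrow> 0 \<le> e \<Longrightarrow> e < d \<Longrightarrow> cmod (\<mu> - z) < d
       \<Longrightarrow> cmod (\<mu> - z - hdot y (E *v x) / hdot y x) \<le> C * e\<^sup>2"
proof -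
  define W where "W = {w. hdot y w = 0}"
  define k where "k = cmod (hdot y x)"
  have "x \<noteq> 0"
    using x(2) by auto
  then have "hdot y x \<noteq> 0"
    by (rule nonorth[OF x(1)])
  then have k: "k > 0"
    by (simp add: k_def)
  have "subspace W"
    unfolding subspace_def W_def by (auto simp: hdot_add hdot_scaleR hdot_def[of y 0])
  moreover have "bounded_linear (\<lambda>w. (A - mat z) *v w)"
    by (rule matrix_vector_mul_bounded_linear)
  moreover have shift: "(A - mat z) *v w = A *v w - z *s w" for w
    by (simp add: matrix_vector_mult_diff_rdistrib mat_vector_mult)
  moreover have "\<forall>w\<in>W. (A - mat z) *v w = 0 \<longrightarrow> w = 0"
    using nonorth by (auto simp: W_def shift)
  ultimately obtain c where c: "c > 0" "\<And>w. w \<in> W \<Longrightarrow> c * norm w \<le> norm (A *v w - z *s w)"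
    using injective_imp_isometric[of W "\<lambda>w. (A - mat z) *v w"] closed_subspace
    by (metis mult.commute)
  show ?thesis
  \<comment> \<open>The radius \<open>c / 4\<close> makes \<open>\<bar>\<mu> - z\<bar> + e < c / 2\<close>, which forces \<open>\<parallel>w\<parallel> \<le> 1\<close> below; then
      \<open>\<bar>\<mu> - z\<bar> \<le> 2 e / k\<close> and \<open>c \<parallel>w\<parallel> \<le> 2 (2 e / k + e)\<close>, whence the constant.\<close>
  proof (rule that[of "c / 4" "(4 / k + 2) / (c * k)"])
    show "c / 4 > 0"
      using c(1) by simp
    fix E e \<mu>
    assume \<mu>: "\<mu> \<in> spectrum (A + E)" and E: "spectral_norm E \<le> e" "0 \<le> e"
      and small: "e < c / 4" "cmod (\<mu> - z) < c / 4"
    have E_le: "norm (E *v v) \<le> e * norm v" for v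
      using E by (simp add: spectral_norm_le_iff)
    define m where "m = cmod (\<mu> - z)"
    have residual: "A *v v - z *s v = (\<mu> - z) *s v - E *v v" if "(A + E) *v v = \<mu> *s v" for v
      using that by (simp add: matrix_vector_mult_add_rdistrib vector_sub_rdistrib algebra_simps)
    have residual_le: "norm (A *v v - z *s v) \<le> (m + e) * norm v" if "(A + E) *v v = \<mu> *s v" for v
      unfolding residual[OF that] m_def
      using norm_triangle_ineq4[of "(\<mu> - z) *s v" "E *v v"] E_le[of v]
      unfolding norm_scalar_vector distrib_right by linarith
    obtain v0 where v0: "v0 \<noteq> 0" "(A + E) *v v0 = \<mu> *s v0"
      using \<mu> by (auto simp: spectrum_def)
    \<comment> \<open>Otherwise \<open>v0\<close> itself would lie in \<open>W\<close>, where \<open>A - z\<close> cannot shrink it that much.\<close>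
    have "hdot y v0 \<noteq> 0"
    proof
      assume "hdot y v0 = 0"
      then have "c * norm v0 \<le> (m + e) * norm v0"
        using c(2)[of v0] residual_le[OF v0(2)] by (simp add: W_def)
      then show False
        using v0(1) small c(1) by (simp add: m_def)
    qed
    define v where "v = (hdot y x / hdot y v0) *s v0"
    define w where "w = v - x"
    have v: "(A + E) *v v = \<mu> *s v"
      unfolding v_def matrix_vector_mult_scalar v0(2) by (simp add: mult.commute)
    have yv: "hdot y v = hdot y x"
      using \<open>hdot y v0 \<noteq> 0\<close> by (simp add: v_def hdot_scalar)
    then have w: "w \<in> W"
      by (simp add: w_def W_def hdot_diff)
    have v_le: "norm v \<le> 1 + norm w"
      using norm_triangle_ineq[of x w] x(2) by (simp add: w_def)
    have "A *v w - z *s w = A *v v - z *s v"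
      by (simp add: w_def matrix_vector_mult_diff_distrib x(1) vec.scale_right_diff_distrib)
    then have "c * norm w \<le> (m + e) * norm v"
      using c(2)[OF w] residual_le[OF v] by simp
    also have "\<dots> \<le> (m + e) * (1 + norm w)"
      using v_le E(2) by (intro mult_left_mono) (simp_all add: m_def)
    finally have w_le: "c * norm w \<le> (m + e) * (1 + norm w)" .
    also have "\<dots> \<le> c / 2 * (1 + norm w)"
      using small by (intro mult_right_mono) (simp_all add: m_def)
    finally have w1: "norm w \<le> 1"
      using c(1) by (simp add: field_simps)
    have "(\<mu> - z) * hdot y x = hdot y (E *v v)"
    proof -
      have "hdot y (A *v v - z *s v) = 0"
        by (simp add: hdot_diff hdot_scalar hdot_left_eigenvector[OF y(1)])
      then show ?thesis
        unfolding residual[OF v] by (simp add: hdot_diff hdot_scalar yv left_diff_distrib)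
    qed
    then have eq: "(\<mu> - z) * hdot y x = hdot y (E *v x) + hdot y (E *v w)"
      by (simp add: w_def hdot_diff matrix_vector_mult_diff_distrib)
    have hdot_E: "cmod (hdot y (E *v u)) \<le> e * norm u" for u
      using norm_hdot_le[of y "E *v u"] E_le[of u] y(2) by simp
    have "m * k = cmod (hdot y (E *v x) + hdot y (E *v w))"
      unfolding eq[symmetric] by (simp add: m_def k_def norm_mult)
    also have "\<dots> \<le> e * norm x + e * norm w"
      by (intro order_trans[OF norm_triangle_ineq] add_mono hdot_E)
    also have "\<dots> \<le> e * 2"
      using x(2) mult_left_mono[OF w1 E(2)] by simp
    finally have m_le: "m \<le> 2 * e / k"
      using k by (simp add: field_simps)
    have "c * norm w \<le> (m + e) * 2"
      using w_le mult_left_mono[of "1 + norm w" 2 "m + e"] w1 E(2) by (simp add: m_def)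
    also have "\<dots> \<le> (4 / k + 2) * e"
      using m_le by (simp add: distrib_right)
    finally have w_small: "norm w \<le> (4 / k + 2) * e / c"
      using c(1) by (simp add: field_simps)
    have "\<mu> - z - hdot y (E *v x) / hdot y x = hdot y (E *v w) / hdot y x"
      using eq \<open>hdot y x \<noteq> 0\<close> by (simp add: field_simps)
    then have "cmod (\<mu> - z - hdot y (E *v x) / hdot y x) = cmod (hdot y (E *v w)) / k"
      by (simp add: norm_divide k_def)
    also have "\<dots> \<le> e * ((4 / k + 2) * e / c) / k"
      using k hdot_E[of w] mult_left_mono[OF w_small E(2)] by (intro divide_right_mono) auto
    also have "\<dots> = (4 / k + 2) / (c * k) * e\<^sup>2"
      by (simp add: power2_eq_square)
    finally show "cmod (\<mu> - z - hdot y (E *v x) / hdot y x) \<le> (4 / k + 2) / (c * k) * e\<^sup>2" .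
  qed
qed

text \<open>The rank-one matrix \<open>\<phi> y x\<^sup>*\<close>, with the phase \<open>\<phi>\<close> of \<open>y\<^sup>* x\<close>, moves the eigenvalue
  straight to the right.\<close>
lemma optimal_direction:
  fixes x y :: "complex ^ 'n"
  assumes "norm x = 1" "norm y = 1" "hdot y x \<noteq> 0"
  obtains \<Delta> where "spectral_norm \<Delta> \<le> 1"
    "hdot y (\<Delta> *v x) / hdot y x = of_real (1 / cmod (hdot y x))"
proof -
  define \<phi> where "\<phi> = sgn (hdot y x)"
  define \<Delta> where "\<Delta> = (\<chi> i j. \<phi> * y $ i * cnj (x $ j))"
  have \<Delta>: "\<Delta> *v u = (\<phi> * hdot x u) *s y" for u
    by (simp add: vec_eq_iff \<Delta>_def matrix_vector_mult_def hdot_def sum_distrib_left sum_distrib_right mult_ac)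
  have "cmod \<phi> = 1"
    using assms(3) by (simp add: \<phi>_def norm_sgn)
  then have "norm (\<Delta> *v u) \<le> 1 * norm u" for u
    using norm_hdot_le[of x u] assms by (simp add: \<Delta> norm_scalar_vector norm_mult)
  then have "spectral_norm \<Delta> \<le> 1"
    by (simp add: spectral_norm_le_iff)
  moreover have "hdot y (\<Delta> *v x) / hdot y x = of_real (1 / cmod (hdot y x))"
    using assms by (simp add: \<Delta> hdot_scalar hdot_self \<phi>_def sgn_eq)
  ultimately show ?thesis
    by (rule that)
qed

section \<open>Maximal real parts\<close>

lemma Max_image_diff_le:
  fixes f g :: "'a \<Rightarrow> real"
  assumes "finite S" "S \<noteq> {}" "\<And>s. s \<in> S \<Longrightarrow> \<bar>f s - g s\<bar> \<le> d"
  shows "\<bar>Max (f ` S) - Max (g ` S)\<bar> \<le> d"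
proof -
  have "f s \<le> Max (g ` S) + d" "g s \<le> Max (f ` S) + d" if "s \<in> S" for s
  proof -
    have "g s \<le> Max (g ` S)" "f s \<le> Max (f ` S)"
      using that assms(1) by simp_all
    then show "f s \<le> Max (g ` S) + d" "g s \<le> Max (f ` S) + d"
      using assms(3)[OF that] by linarith+
  qed
  then have "Max (f ` S) \<le> Max (g ` S) + d" "Max (g ` S) \<le> Max (f ` S) + d"
    using assms(1,2) by (simp_all add: Max_le_iff)
  then show ?thesis by linarith
qed

lemma Greatest_in_compact:
  fixes K :: "real set"
  assumes "compact K" "K \<noteq> {}"
  shows "(GREATEST t. t \<in> K) \<in> K" and "\<And>s. s \<in> K \<Longrightarrow> s \<le> (GREATEST t. t \<in> K)"
proof -
  obtain m where m: "m \<in> K" "\<And>s. s \<in> K \<Longrightarrow> s \<le> m"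
    using compact_attains_sup[OF assms] by blast
  then have "(GREATEST t. t \<in> K) = m"
    by (intro Greatest_equality) auto
  then show "(GREATEST t. t \<in> K) \<in> K" "\<And>s. s \<in> K \<Longrightarrow> s \<le> (GREATEST t. t \<in> K)"
    using m by auto
qed

definition ball_eigenvalue :: "complex \<Rightarrow> real \<Rightarrow> complex ^ 'n ^ 'n \<Rightarrow> complex" where
  "ball_eigenvalue z \<rho> B = (THE w. w \<in> spectrum B \<and> w \<in> ball z \<rho>)"

lemma spectrum_Int_ball:
  assumes "\<exists>w. spectrum B \<inter> ball z \<rho> = {w}"
  shows "spectrum B \<inter> ball z \<rho> = {ball_eigenvalue z \<rho> B}"
proof -
  obtain w where w: "spectrum B \<inter> ball z \<rho> = {w}"
    by (rule exE[OF assms])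
  then have "v \<in> spectrum B \<and> v \<in> ball z \<rho> \<longleftrightarrow> v = w" for v
    by (simp only: set_eq_iff Int_iff singleton_iff)
  then have "ball_eigenvalue z \<rho> B = w"
    by (simp only: ball_eigenvalue_def the_eq_trivial)
  then show ?thesis
    by (simp only: w)
qed

text \<open>An operator \<open>GREATEST\<close> tells something only if the maximum exists. This is where compactness
  of the ball of matrices and continuity of the eigenvalue enter.\<close>
lemma max_real_part_attained:
  fixes A :: "complex ^ 'n ^ 'n"
  assumes "e > 0"
    and unique: "\<And>B. B \<in> spectral_cball A e \<Longrightarrow> \<exists>w. spectrum B \<inter> ball z \<rho> = {w}"
  shows "\<exists>B\<in>spectral_cball A e. max_real_part A \<rho> e z = Re (ball_eigenvalue z \<rho> B)"
    and "\<And>B. B \<in> spectral_cball A e \<Longrightarrow> Re (ball_eigenvalue z \<rho> B) \<le> max_real_part A \<rho> e z"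
proof -
  define K where "K = (\<lambda>B. Re (ball_eigenvalue z \<rho> B)) ` spectral_cball A e"
  have "continuous_on (spectral_cball A e) (ball_eigenvalue z \<rho>)"
    by (rule continuous_on_unique_eigenvalue[OF open_ball spectrum_Int_ball[OF unique]])
  then have "compact K"
    unfolding K_def using assms(1)
    by (intro compact_continuous_image continuous_on_Re compact_spectral_cball) simp_all
  moreover have "A \<in> spectral_cball A e"
    using assms(1) by (simp add: centre_in_spectral_cball)
  then have "K \<noteq> {}"
    by (auto simp: K_def)
  moreover have "max_real_part A \<rho> e z = (GREATEST t. t \<in> K)"
    by (simp add: K_def max_real_part_def perturbed_eigenvalue_def ball_eigenvalue_def
        spectral_cball_eq_image[OF assms(1)] image_image)
  ultimately have "max_real_part A \<rho> e z \<in> K" "\<And>t. t \<in> K \<Longrightarrow> t \<le> max_real_part A \<rho> e z"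
    using Greatest_in_compact[of K] by auto
  then show "\<exists>B\<in>spectral_cball A e. max_real_part A \<rho> e z = Re (ball_eigenvalue z \<rho> B)"
    "\<And>B. B \<in> spectral_cball A e \<Longrightarrow> Re (ball_eigenvalue z \<rho> B) \<le> max_real_part A \<rho> e z"
    by (auto simp: K_def)
qed

lemma pseudospectrum_eq: "pseudospectrum e A = (\<Union>B\<in>spectral_cball A e. spectrum B)"
proof -
  have "spectral_cball A e = (\<lambda>\<Delta>. A + \<Delta>) ` {\<Delta>. spectral_norm \<Delta> \<le> e}"
    unfolding spectral_cball_def image_def by (auto intro: exI[of _ "_ - A"])
  then show ?thesis
    by (simp add: pseudospectrum_def)
qed

text \<open>The expansion is valid only for eigenvalues that are already close to \<open>z\<close>, whereas the ball of
  radius \<open>\<rho>\<close> is fixed. Continuity of the selected eigenvalue at \<open>A\<close> closes this gap for small \<open>e\<close>.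
  The upper bound then follows from evaluating the expansion at a maximiser, the lower bound from
  evaluating it in the optimal direction.\<close>
lemma max_real_part_first_order:
  fixes A :: "complex ^ 'n ^ 'n"
  assumes "e0 > 0" and card: "card (spectrum A) = CARD('n)"
    and z: "z \<in> spectrum A" "\<rho> > 0"
    and unique: "\<And>B. B \<in> spectral_cball A e0 \<Longrightarrow> \<exists>w. spectrum B \<inter> ball z \<rho> = {w}"
    and x: "unit_right_eigenvector A z x" and y: "unit_left_eigenvector A z y"
  shows "(\<lambda>e. max_real_part A \<rho> e z - (Re z + e * (1 / cmod (hdot y x)))) \<in> O[at_right 0](\<lambda>e. e\<^sup>2)"
proof -
  define g :: "complex ^ 'n ^ 'n \<Rightarrow> complex" where "g = ball_eigenvalue z \<rho>"
  have g: "spectrum B \<inter> ball z \<rho> = {g B}" if "B \<in> spectral_cball A e0" for B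
    unfolding g_def by (rule spectrum_Int_ball[OF unique[OF that]])
  have A: "A \<in> spectral_cball A e0"
    using assms(1) by (simp add: centre_in_spectral_cball)
  have gA: "g A = z"
    using g[OF A] z by (metis IntI singletonD centre_in_ball)
  have cont: "continuous_on (spectral_cball A e0) g"
    by (rule continuous_on_unique_eigenvalue[OF open_ball g])
  have x': "A *v x = z *s x" "norm x = 1" and y': "conj_vec y v* A = z *s conj_vec y" "norm y = 1"
    using x y by (auto simp: unit_right_eigenvector_def unit_left_eigenvector_def)
  have "y \<noteq> 0"
    using y'(2) by auto
  note nonorth = left_right_eigenvectors_not_orthogonal[OF card y'(1) this]
  obtain C d where d: "d > 0" and first_order:
    "\<And>E e \<mu>. \<mu> \<in> spectrum (A + E) \<Longrightarrow> spectral_norm E \<le> e \<Longrightarrow> 0 \<le> e \<Longrightarrow> e < d \<Longrightarrow> cmod (\<mu> - z) < d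
       \<Longrightarrow> cmod (\<mu> - z - hdot y (E *v x) / hdot y x) \<le> C * e\<^sup>2"
    by (rule eigenvalue_first_order[OF y' x']) (erule (1) nonorth, rule that)
  have "x \<noteq> 0"
    using x'(2) by auto
  then have yx: "hdot y x \<noteq> 0"
    by (rule nonorth[OF x'(1)])
  define k where "k = cmod (hdot y x)"
  have k: "k > 0"
    using yx by (simp add: k_def)
  obtain s where s: "s > 0"
    "\<And>B. B \<in> spectral_cball A e0 \<Longrightarrow> dist B A < s \<Longrightarrow> cmod (g B - z) < d"
    using cont A d gA unfolding continuous_on_iff by (metis dist_norm)
  obtain \<Delta> where \<Delta>: "spectral_norm \<Delta> \<le> 1" "hdot y (\<Delta> *v x) / hdot y x = of_real (1 / k)"
    unfolding k_def by (rule optimal_direction[OF x'(2) y'(2) yx])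
  define N where "N = real CARD('n) * real CARD('n)"
  have N: "N > 0"
    by (simp add: N_def)
  \<comment> \<open>\<open>N\<close> converts the spectral norm into the Frobenius norm, in which \<open>s\<close> is measured.\<close>
  define b where "b = min e0 (min d (s / N))"
  have "b > 0"
    using assms(1) d s N by (simp add: b_def)
  have "\<bar>max_real_part A \<rho> e z - (Re z + e * (1 / k))\<bar> \<le> C * e\<^sup>2" if "0 < e" "e < b" for e
  proof -
    have e: "e \<le> e0" "e < d" "N * e < s"
      using that N by (auto simp: b_def pos_less_divide_eq mult.commute)
    have sub: "spectral_cball A e \<subseteq> spectral_cball A e0"
      using e(1) by (auto simp: spectral_cball_def)
    have expand: "cmod (g B - z - hdot y ((B - A) *v x) / hdot y x) \<le> C * e\<^sup>2"
      if B: "B \<in> spectral_cball A e" for B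
    proof (rule first_order)
      show BA: "spectral_norm (B - A) \<le> e"
        using B by (simp add: spectral_cball_def)
      have "dist B A \<le> N * e"
        using norm_le_spectral_norm[OF BA] that(1) \<open>0 < e\<close> by (simp add: dist_norm N_def mult.assoc)
      then show "cmod (g B - z) < d"
        using s(2) B sub e(3) by force
      show "g B \<in> spectrum (A + (B - A))"
        using g B sub by force
    qed (use \<open>0 < e\<close> e in auto)
    have max: "\<exists>B\<in>spectral_cball A e. max_real_part A \<rho> e z = Re (g B)"
      "\<And>B. B \<in> spectral_cball A e \<Longrightarrow> Re (g B) \<le> max_real_part A \<rho> e z"
      unfolding g_def using max_real_part_attained[OF \<open>0 < e\<close> unique[OF subsetD[OF sub]]] by auto
    have "max_real_part A \<rho> e z \<le> Re z + e * (1 / k) + C * e\<^sup>2"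
    proof -
      obtain B where B: "B \<in> spectral_cball A e" "max_real_part A \<rho> e z = Re (g B)"
        using max(1) by blast
      have "Re (hdot y ((B - A) *v x) / hdot y x) \<le> cmod (hdot y ((B - A) *v x)) / k"
        using complex_Re_le_cmod by (metis norm_divide k_def)
      also have "\<dots> \<le> e / k"
      proof (rule divide_right_mono)
        have "norm ((B - A) *v x) \<le> e"
          using B(1) \<open>0 < e\<close> x'(2) by (auto simp: spectral_cball_eq dest: spec[of _ x])
        then show "cmod (hdot y ((B - A) *v x)) \<le> e"
          using norm_hdot_le[of y "(B - A) *v x"] y'(2) by simp
      qed (use k in simp)
      finally show ?thesis
        using expand[OF B(1)] complex_Re_le_cmod[of "g B - z - hdot y ((B - A) *v x) / hdot y x"] B(2)
        by simp
    qed
    moreover have "Re z + e * (1 / k) - C * e\<^sup>2 \<le> max_real_part A \<rho> e z"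
    proof -
      define B where "B = A + e *\<^sub>R \<Delta>"
      have B: "B \<in> spectral_cball A e"
        using \<Delta>(1) \<open>0 < e\<close> by (auto simp: B_def spectral_cball_eq_image)
      have "hdot y ((B - A) *v x) / hdot y x = of_real e * (hdot y (\<Delta> *v x) / hdot y x)"
        by (simp add: B_def scaleR_matrix_vector hdot_scaleR)
      also have "\<dots> = of_real (e / k)"
        unfolding \<Delta>(2) by simp
      finally have "cmod (g B - z - of_real (e / k)) \<le> C * e\<^sup>2"
        using expand[OF B] by simp
      then have "\<bar>Re (g B) - Re z - e / k\<bar> \<le> C * e\<^sup>2"
        using abs_Re_le_cmod[of "g B - z - of_real (e / k)"] by simp
      moreover have "Re (g B) \<le> max_real_part A \<rho> e z"
        by (rule max(2)[OF B])
      ultimately show ?thesis by simp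
    qed
    ultimately show ?thesis by (simp add: abs_le_iff)
  qed
  then have "\<forall>\<^sub>F e in at_right 0. \<bar>max_real_part A \<rho> e z - (Re z + e * (1 / k))\<bar> \<le> C * e\<^sup>2"
    using eventually_at_right_less[of 0] eventually_at_right[OF \<open>b > 0\<close>]
    by (auto intro: exI[of _ b] simp: \<open>b > 0\<close>)
  then show ?thesis
    unfolding k_def[symmetric] by (intro bigoI[where c = C]) (simp add: eventually_mono)
qed

theorem theorem4p1:
  fixes A :: "complex ^ 'n ^ 'n"
    and U :: "real set"
    and r :: "complex \<Rightarrow> real"
    and x y :: "complex \<Rightarrow> complex ^ 'n"
  assumes "open U" and "is_interval U"
    and "\<And>\<mu>0. \<mu>0 \<in> spectrum A \<Longrightarrow> r \<mu>0 > 0"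
    and "\<And>\<mu>0 \<eta> \<Delta>. \<mu>0 \<in> spectrum A \<Longrightarrow> \<eta> \<in> U \<Longrightarrow> spectral_norm \<Delta> \<le> 1 \<Longrightarrow>
           \<exists>z. spectrum (A + \<eta> *\<^sub>R \<Delta>) \<inter> ball \<mu>0 (r \<mu>0) = {z} \<and> simple_eigenvalue (A + \<eta> *\<^sub>R \<Delta>) z"
    and "\<And>\<mu>0. \<mu>0 \<in> spectrum A \<Longrightarrow> unit_right_eigenvector A \<mu>0 (x \<mu>0)"
    and "\<And>\<mu>0. \<mu>0 \<in> spectrum A \<Longrightarrow> unit_left_eigenvector A \<mu>0 (y \<mu>0)"
  shows "\<exists>R. R \<in> O[at_right 0](\<lambda>\<epsilon>. \<epsilon>\<^sup>2) \<and>
    (\<forall>\<epsilon>::real. \<epsilon> > 0 \<and> {0..\<epsilon>} \<subseteq> U \<longrightarrow>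
       pseudospectral_abscissa \<epsilon> A = Max ((\<lambda>\<mu>0. max_real_part A (r \<mu>0) \<epsilon> \<mu>0) ` spectrum A) \<and>
       Max ((\<lambda>\<mu>0. max_real_part A (r \<mu>0) \<epsilon> \<mu>0) ` spectrum A) =
         Max ((\<lambda>\<mu>0. Re \<mu>0 + \<epsilon> * (1 / cmod (hdot (y \<mu>0) (x \<mu>0)))) ` spectrum A) + R \<epsilon>)"
proof (cases "\<exists>\<epsilon>>0. {0..\<epsilon>} \<subseteq> U")
  \<comment> \<open>There is no \<open>\<epsilon>\<close> to consider, so any remainder will do.\<close>
  case False
  then show ?thesis
    by (intro exI[of _ "\<lambda>_. 0"]) auto
next
  case True
  then obtain e0 where e0: "e0 > 0" "{0..e0} \<subseteq> U"
    by blast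
  have unique: "\<exists>w. spectrum B \<inter> ball z (r z) = {w}"
    if z: "z \<in> spectrum A" and e: "e > 0" "{0..e} \<subseteq> U" and B: "B \<in> spectral_cball A e" for z e B
  proof -
    obtain \<Delta> where "spectral_norm \<Delta> \<le> 1" "B = A + e *\<^sub>R \<Delta>"
      using B spectral_cball_eq_image[OF e(1)] by blast
    moreover have "e \<in> U"
      using e by auto
    ultimately show ?thesis
      using assms(4)[OF z] by metis
  qed
  have simple: "simple_eigenvalue A z" if z: "z \<in> spectrum A" for z
  proof -
    have "0 \<in> U"
      using e0 by auto
    moreover have "spectral_norm (0 :: complex ^ 'n ^ 'n) \<le> 1"
      by (simp add: spectral_norm_le_iff)
    ultimately obtain w where w: "spectrum A \<inter> ball z (r z) = {w}" "simple_eigenvalue A w"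
      using assms(4)[OF z, of 0 0] by auto
    have "z \<in> spectrum A \<inter> ball z (r z)"
      using z assms(3)[OF z] by simp
    then show ?thesis
      using w by simp
  qed
  define m where "m e z = max_real_part A (r z) e z" for e z
  define l where "l e z = Re z + e * (1 / cmod (hdot (y z) (x z)))" for e z
  define R where "R e = Max (m e ` spectrum A) - Max (l e ` spectrum A)" for e
  have R: "R \<in> O[at_right 0](\<lambda>\<epsilon>. \<epsilon>\<^sup>2)"
  proof -
    have each: "(\<lambda>e. m e z - l e z) \<in> O[at_right 0](\<lambda>e. e\<^sup>2)" if "z \<in> spectrum A" for z
      unfolding m_def l_def
      by (rule max_real_part_first_order[OF e0(1) card_spectrum_simple[OF simple] that assms(3)[OF that]
            unique[OF that e0] assms(5)[OF that] assms(6)[OF that]])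
    have "(\<lambda>e. \<Sum>z\<in>spectrum A. \<bar>m e z - l e z\<bar>) \<in> O[at_right 0](\<lambda>e. e\<^sup>2)"
      using each by (intro big_sum_in_bigo) simp
    moreover have "\<bar>R e\<bar> \<le> (\<Sum>z\<in>spectrum A. \<bar>m e z - l e z\<bar>)" for e
      unfolding R_def using member_le_sum[of _ "spectrum A" "\<lambda>z. \<bar>m e z - l e z\<bar>"]
      by (intro Max_image_diff_le finite_spectrum spectrum_nonempty) (simp add: finite_spectrum)
    then have "R \<in> O[at_right 0](\<lambda>e. \<Sum>z\<in>spectrum A. \<bar>m e z - l e z\<bar>)"
      by (intro bigoI[where c = 1] always_eventually) (simp add: order_trans[OF _ abs_ge_self])
    ultimately show ?thesis
      by (rule landau_o.big_trans[rotated])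
  qed
  have abscissa: "pseudospectral_abscissa e A = Max (m e ` spectrum A)" if e: "e > 0" "{0..e} \<subseteq> U" for e
  proof -
    define S where "S = spectral_cball A e"
    have A: "A \<in> S"
      using e(1) by (simp add: S_def centre_in_spectral_cball)
    have unique': "\<exists>w. spectrum B \<inter> ball z (r z) = {w}" if "z \<in> spectrum A" "B \<in> S" for z B
      using unique[OF that(1) e] that(2) by (simp add: S_def)
    have abscissas: "Re ` pseudospectrum e A = (\<Union>z\<in>spectrum A. (\<lambda>B. Re (ball_eigenvalue z (r z) B)) ` S)"
    proof -
      have "spectrum B = (\<lambda>z. ball_eigenvalue z (r z) B) ` spectrum A" if "B \<in> S" for B
      proof (rule spectrum_eq_continued_eigenvalues[where D = "\<lambda>z. ball z (r z)", OF _ A that simple])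
        show "connected S"
          using e(1) by (simp add: S_def convex_connected convex_spectral_cball)
        show "spectrum B \<inter> ball z (r z) = {ball_eigenvalue z (r z) B}" if "z \<in> spectrum A" "B \<in> S" for z B
          by (rule spectrum_Int_ball[OF unique'[OF that]])
      qed (use assms(3) in simp_all)
      then have "pseudospectrum e A = (\<Union>B\<in>S. (\<lambda>z. ball_eigenvalue z (r z) B) ` spectrum A)"
        by (simp add: pseudospectrum_eq S_def)
      then show ?thesis
        by auto
    qed
    have m: "\<exists>B\<in>S. m e z = Re (ball_eigenvalue z (r z) B)"
      "\<And>B. B \<in> S \<Longrightarrow> Re (ball_eigenvalue z (r z) B) \<le> m e z" if "z \<in> spectrum A" for z
      unfolding m_def S_def using max_real_part_attained[OF e(1) unique[OF that e]] by auto
    show ?thesis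
      unfolding pseudospectral_abscissa_def
    proof (rule Greatest_equality)
      have "Max (m e ` spectrum A) \<in> m e ` spectrum A"
        by (intro Max_in) (simp_all add: finite_spectrum spectrum_nonempty)
      then obtain z where "z \<in> spectrum A" "Max (m e ` spectrum A) = m e z"
        by blast
      then show "Max (m e ` spectrum A) \<in> Re ` pseudospectrum e A"
        unfolding abscissas using m(1)[of z] by auto
    next
      fix t assume "t \<in> Re ` pseudospectrum e A"
      then obtain z B where z: "z \<in> spectrum A" and B: "B \<in> S" "t = Re (ball_eigenvalue z (r z) B)"
        unfolding abscissas by blast
      have "t \<le> m e z"
        using m(2)[OF z B(1)] B(2) by simp
      also have "\<dots> \<le> Max (m e ` spectrum A)"
        using z by (simp add: finite_spectrum)
      finally show "t \<le> Max (m e ` spectrum A)" .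
    qed
  qed
  show ?thesis
    unfolding m_def[symmetric] l_def[symmetric]
    by (intro exI[of _ R] conjI allI impI R) (simp_all add: abscissa R_def)
qed

end
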